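(* Let $\mathcal F$ be a simplicial function space, and let $\mathcal T$ be a simplicial complex with maximal dimension $n$. Let $\mathfrak T$ be the partially ordered set of all faces (vertices, edges, two-dimensional faces, etc.) of $\mathcal T$, ordered by inclusion. Then there exist local extension operators $E_K^{\mathcal T}\colon\mathring{\mathcal F}(K)\to\mathcal F(\mathcal T)$ for every $K\in\mathfrak T$ if and only if there exist simplicial extension operators $E_m\colon\mathring{\mathcal F}(T^m)\to\mathcal F(Q^{m+1})$ for every dimension $m$ with $0\le m<n$.
   Context: All vector spaces are over a fixed field. Faces of a simplex are nonempty, and $K\le F$ means that $K$ is a face of $F$ (possibly $K=F$). A simplicial map between simplices $K$ and $F$ is an affine function $K\to F$ that sends vertices to vertices (not necessarily injective). A simplicial function space $\mathcal F$ assigns a vector space $\mathcal F(F)$ to every simplex $F$ and a linear map $\Phi^*\colon\mathcal F(F)\to\mathcal F(K)$ (pullback) to every simplicial map $\Phi\colon K\to F$, such that $\mathrm{id}_F^*$ is the identity on $\mathcal F(F)$ and $(\Psi\circ\Phi)^*=\Phi^*\Psi^*$ for all simplicial maps $\Phi\colon K\to G$, $\Psi\colon G\to F$. For $K\le F$, the trace $\operatorname{tr}^F_K\colon\mathcal F(F)\to\mathcal F(K)$ is the pullback via the inclusion $K\hookrightarrow F$. The subspace of vanishing trace is $\mathring{\mathcal F}(F)=\{\phi\in\mathcal F(F)\mid\operatorname{tr}^F_K\phi=0\text{ for all }K<F\}$. The global function space is $$\mathcal F(\mathcal T)=\Big\{(\phi_F)_{F\in\mathfrak T}\in\prod_{F\in\mathfrak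 T}\mathcal F(F)\;\Big|\;\operatorname{tr}^F_K\phi_F=\phi_K\text{ for all }K\le F\Big\},$$ with $\operatorname{tr}^{\mathcal T}_F\colon\mathcal F(\mathcal T)\to\mathcal F(F)$ the natural projections. For $K\in\mathfrak T$, a local extension operator is a linear map $E^{\mathcal T}_K\colon\mathring{\mathcal F}(K)\to\mathcal F(\mathcal T)$ such that $\operatorname{tr}^{\mathcal T}_KE^{\mathcal T}_K\colon\mathring{\mathcal F}(K)\to\mathcal F(K)$ is the inclusion and $\operatorname{tr}^{\mathcal T}_FE^{\mathcal T}_K=0$ for all $F\in\mathfrak T$ with $K\not\le F$. Let $\mathbb R^{m+1}$ have coordinates $(\lambda_0,\dots,\lambda_m)$ and standard basis vectors $e_0,\dots,e_m$. $T^m$ is the simplex with vertices $e_0,\dots,e_m$, and $Q^{m+1}$ is the simplex with vertices $0,e_0,\dots,e_m$; thus $T^m$ is a face of $Q^{m+1}$. A simplicial extension operator in dimension $m$ is a linear map $E_m\colon\mathring{\mathcal F}(T^m)\to\mathcal F(Q^{m+1})$ such that $\operatorname{tr}^{Q^{m+1}}_{T^m}E_m\colon\mathring{\mathcal F}(T^m)\to\mathcal F(T^m)$ is the inclusion and $\operatorname{tr}^{Q^{m+1}}_SE_m=0$ for every face $S$ of $Q^{m+1}$ with $T^m\not\le S$ (i.e. every face other than $T^m$ and $Q^{m+1}$). *)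

theory Defs
  imports "HOL-Analysis.Analysis" "HOL-Analysis.Finite_Function_Topology"
    "HOL-Algebra.Module"
begin

section \<open>Simplices, simplicial maps and simplicial complexes\<close>

text \<open>
  The ambient space is the union of all the spaces \<open>\<real>\<^sup>N\<close>: real sequences with
  finite support, where \<open>\<real>\<^sup>N\<close> consists of the sequences supported in \<open>{..<N}\<close>.
  Thus a simplex of any \<open>\<real>\<^sup>N\<close> is a subset of this one type.  The library's
  \<open>simplex\<close> and \<open>simplicial_complex\<close> need a type of class \<open>euclidean_space\<close>, so
  they do not apply; \<open>face_of\<close> and \<open>extreme_point_of\<close> do.
\<close>

type_synonym point = "nat \<Rightarrow>\<^sub>0 real"

definition is_simplex :: "point set \<Rightarrow> bool" where
  "is_simplex F \<longleftrightarrow>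
     (\<exists>C. finite C \<and> C \<noteq> {} \<and> \<not> affine_dependent C \<and> F = convex hull C)"

definition vertices :: "point set \<Rightarrow> point set" where
  "vertices F = {x. x extreme_point_of F}"

definition simplex_dim :: "point set \<Rightarrow> nat" where
  "simplex_dim F = card (vertices F) - 1"

text \<open>The library relation \<open>face_of\<close> also counts the empty set as a face.\<close>

definition face_le :: "point set \<Rightarrow> point set \<Rightarrow> bool" (infix \<open>\<unlhd>\<close> 50) where
  "K \<unlhd> F \<longleftrightarrow> K \<noteq> {} \<and> K face_of F"

definition face_less :: "point set \<Rightarrow> point set \<Rightarrow> bool" (infix \<open>\<lhd>\<^sub>f\<close> 50) where
  "K \<lhd>\<^sub>f F \<longleftrightarrow> K \<unlhd> F \<and> K \<noteq> F"

definition affine_fun_on :: "point set \<Rightarrow> (point \<Rightarrow> point) \<Rightarrow> bool" where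
  "affine_fun_on K \<Phi> \<longleftrightarrow> (\<exists>L c. linear L \<and> (\<forall>x\<in>K. \<Phi> x = L x + c))"

text \<open>
  Maps out of \<open>K\<close> are represented by functions that are \<open>undefined\<close> off \<open>K\<close>, so that
  maps which agree on \<open>K\<close> are equal.
\<close>

definition simplicial_map :: "point set \<Rightarrow> point set \<Rightarrow> (point \<Rightarrow> point) \<Rightarrow> bool" where
  "simplicial_map K F \<Phi> \<longleftrightarrow>
     \<Phi> \<in> K \<rightarrow>\<^sub>E F \<and> affine_fun_on K \<Phi> \<and> \<Phi> ` vertices K \<subseteq> vertices F"

text \<open>
  A complex is given by its set of (nonempty) faces; it may be infinite.
\<close>

definition is_simplicial_complex :: "point set set \<Rightarrow> bool" where
  "is_simplicial_complex \<TT> \<longleftrightarrow>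
     (\<forall>F\<in>\<TT>. is_simplex F) \<and>
     (\<forall>F\<in>\<TT>. \<forall>K. K \<unlhd> F \<longrightarrow> K \<in> \<TT>) \<and>
     (\<forall>F\<in>\<TT>. \<forall>F'\<in>\<TT>. F \<inter> F' \<noteq> {} \<longrightarrow> F \<inter> F' \<unlhd> F \<and> F \<inter> F' \<unlhd> F')"

definition max_dim :: "point set set \<Rightarrow> nat \<Rightarrow> bool" where
  "max_dim \<TT> n \<longleftrightarrow> (\<exists>F\<in>\<TT>. simplex_dim F = n) \<and> (\<forall>F\<in>\<TT>. simplex_dim F \<le> n)"

definition basis_point :: "nat \<Rightarrow> point" where
  "basis_point i = Poly_Mapping.single i 1"

definition T_simplex :: "nat \<Rightarrow> point set" where
  "T_simplex m = convex hull (basis_point ` {0..m})"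

text \<open>
  The argument is the dimension: the simplex on \<open>0, e\<^sub>0, \<dots>, e\<^sub>m\<close> is \<open>Q_simplex (m + 1)\<close>.
\<close>

definition Q_simplex :: "nat \<Rightarrow> point set" where
  "Q_simplex d = convex hull (insert 0 (basis_point ` {0..<d}))"


section \<open>Simplicial function spaces\<close>

definition linear_map ::
  "('k, 'r) ring_scheme \<Rightarrow> ('k, 'v, 'a) module_scheme \<Rightarrow> ('k, 'w, 'b) module_scheme
     \<Rightarrow> ('v \<Rightarrow> 'w) \<Rightarrow> bool" where
  "linear_map k V W f \<longleftrightarrow>
     f \<in> carrier V \<rightarrow> carrier W \<and>
     (\<forall>x\<in>carrier V. \<forall>y\<in>carrier V. f (x \<oplus>\<^bsub>V\<^esub> y) = f x \<oplus>\<^bsub>W\<^esub> f y) \<and>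
     (\<forall>a\<in>carrier k. \<forall>x\<in>carrier V. f (a \<odot>\<^bsub>V\<^esub> x) = a \<odot>\<^bsub>W\<^esub> f x)"

text \<open>
  \<open>\<F> F\<close> is the vector space assigned to the simplex \<open>F\<close>, and \<open>pull K F \<Phi>\<close> is the
  pullback \<open>\<Phi>\<^sup>* : \<F> F \<rightarrow> \<F> K\<close> along \<open>\<Phi> : K \<rightarrow> F\<close>.  The spaces \<open>\<F> F\<close> have unrelated
  operations and may overlap; they only share the type of their elements.
\<close>

locale simplicial_function_space =
  fixes k :: "('k, 'r) ring_scheme"
    and \<F> :: "point set \<Rightarrow> ('k, 'v) module"
    and pull :: "point set \<Rightarrow> point set \<Rightarrow> (point \<Rightarrow> point) \<Rightarrow> 'v \<Rightarrow> 'v"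
  assumes scalar_field: "field k"
    and vector_space: "is_simplex F \<Longrightarrow> Module.module k (\<F> F)"
    and pull_linear:
      "\<lbrakk>is_simplex K; is_simplex F; simplicial_map K F \<Phi>\<rbrakk>
        \<Longrightarrow> linear_map k (\<F> F) (\<F> K) (pull K F \<Phi>)"
    and pull_id:
      "\<lbrakk>is_simplex F; \<phi> \<in> carrier (\<F> F)\<rbrakk> \<Longrightarrow> pull F F (\<lambda>x\<in>F. x) \<phi> = \<phi>"
    and pull_comp:
      "\<lbrakk>is_simplex K; is_simplex G; is_simplex F;
        simplicial_map K G \<Phi>; simplicial_map G F \<Psi>; \<phi> \<in> carrier (\<F> F)\<rbrakk>
        \<Longrightarrow> pull K F (compose K \<Psi> \<Phi>) \<phi> = pull K G \<Phi> (pull G F \<Psi> \<phi>)"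

definition tr ::
  "(point set \<Rightarrow> point set \<Rightarrow> (point \<Rightarrow> point) \<Rightarrow> 'v \<Rightarrow> 'v)
     \<Rightarrow> point set \<Rightarrow> point set \<Rightarrow> 'v \<Rightarrow> 'v" where
  "tr pull F K = pull K F (\<lambda>x\<in>K. x)"

definition vanishing_trace ::
  "(point set \<Rightarrow> ('k, 'v) module)
     \<Rightarrow> (point set \<Rightarrow> point set \<Rightarrow> (point \<Rightarrow> point) \<Rightarrow> 'v \<Rightarrow> 'v)
     \<Rightarrow> point set \<Rightarrow> ('k, 'v) module" where
  "vanishing_trace \<F> pull F =
     (\<F> F)\<lparr>carrier :=
        {\<phi> \<in> carrier (\<F> F). \<forall>K. K \<lhd>\<^sub>f F \<longrightarrow> tr pull F K \<phi> = \<zero>\<^bsub>\<F> K\<^esub>}\<rparr>"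

text \<open>
  The ring multiplication fields \<open>mult\<close> and \<open>one\<close> of a \<open>module\<close> record play no role for
  modules, and are left unspecified.
\<close>

definition global_space ::
  "(point set \<Rightarrow> ('k, 'v) module)
     \<Rightarrow> (point set \<Rightarrow> point set \<Rightarrow> (point \<Rightarrow> point) \<Rightarrow> 'v \<Rightarrow> 'v)
     \<Rightarrow> point set set \<Rightarrow> ('k, point set \<Rightarrow> 'v) module" where
  "global_space \<F> pull \<TT> =
     \<lparr>carrier = {\<phi> \<in> (\<Pi>\<^sub>E F\<in>\<TT>. carrier (\<F> F)).
                  \<forall>F\<in>\<TT>. \<forall>K\<in>\<TT>. K \<unlhd> F \<longrightarrow> tr pull F K (\<phi> F) = \<phi> K},
      mult = undefined,
      one = undefined,
      zero = (\<lambda>F\<in>\<TT>. \<zero>\<^bsub>\<F> F\<^esub>),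
      add = (\<lambda>\<phi> \<psi>. \<lambda>F\<in>\<TT>. \<phi> F \<oplus>\<^bsub>\<F> F\<^esub> \<psi> F),
      smult = (\<lambda>a \<phi>. \<lambda>F\<in>\<TT>. a \<odot>\<^bsub>\<F> F\<^esub> \<phi> F)\<rparr>"

definition global_trace :: "point set \<Rightarrow> (point set \<Rightarrow> 'v) \<Rightarrow> 'v" where
  "global_trace F \<phi> = \<phi> F"

definition local_extension_operator ::
  "('k, 'r) ring_scheme \<Rightarrow> (point set \<Rightarrow> ('k, 'v) module)
     \<Rightarrow> (point set \<Rightarrow> point set \<Rightarrow> (point \<Rightarrow> point) \<Rightarrow> 'v \<Rightarrow> 'v)
     \<Rightarrow> point set set \<Rightarrow> point set \<Rightarrow> ('v \<Rightarrow> point set \<Rightarrow> 'v) \<Rightarrow> bool" where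
  "local_extension_operator k \<F> pull \<TT> K E \<longleftrightarrow>
     linear_map k (vanishing_trace \<F> pull K) (global_space \<F> pull \<TT>) E \<and>
     (\<forall>\<phi> \<in> carrier (vanishing_trace \<F> pull K).
        global_trace K (E \<phi>) = \<phi> \<and>
        (\<forall>F\<in>\<TT>. \<not> K \<unlhd> F \<longrightarrow> global_trace F (E \<phi>) = \<zero>\<^bsub>\<F> F\<^esub>))"

definition simplicial_extension_operator ::
  "('k, 'r) ring_scheme \<Rightarrow> (point set \<Rightarrow> ('k, 'v) module)
     \<Rightarrow> (point set \<Rightarrow> point set \<Rightarrow> (point \<Rightarrow> point) \<Rightarrow> 'v \<Rightarrow> 'v)
     \<Rightarrow> nat \<Rightarrow> ('v \<Rightarrow> 'v) \<Rightarrow> bool" where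
  "simplicial_extension_operator k \<F> pull m E \<longleftrightarrow>
     linear_map k (vanishing_trace \<F> pull (T_simplex m)) (\<F> (Q_simplex (m + 1))) E \<and>
     (\<forall>\<phi> \<in> carrier (vanishing_trace \<F> pull (T_simplex m)).
        tr pull (Q_simplex (m + 1)) (T_simplex m) (E \<phi>) = \<phi> \<and>
        (\<forall>S. S \<unlhd> Q_simplex (m + 1) \<and> \<not> T_simplex m \<unlhd> S \<longrightarrow>
           tr pull (Q_simplex (m + 1)) S (E \<phi>) = \<zero>\<^bsub>\<F> S\<^esub>))"

end

theory Submission
  imports Defs
begin

text \<open>
  The idea is that everything is governed by vertices.  Faces of a simplex are the hulls of nonempty
  sets of vertices, and every map of vertices extends to a unique simplicial map.  A simplicial
  function space is therefore a contravariant functor on finite vertex sets.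

  From simplicial to local operators.  Let \<open>K\<close> be a face of dimension \<open>m\<close>, and choose a bijection of
  its vertices with those of \<open>T\<^sup>m\<close>.  A simplex \<open>F\<close> that contains \<open>K\<close> maps to \<open>Q\<^sup>m\<^sup>+\<^sup>1\<close> by this
  bijection on \<open>K\<close> and by sending all other vertices to the origin.  Move a function of vanishing
  trace on \<open>K\<close> to \<open>T\<^sup>m\<close>, extend it to \<open>Q\<^sup>m\<^sup>+\<^sup>1\<close> by \<open>E\<^sub>m\<close>, and pull the result back to \<open>F\<close>.  On \<open>K\<close>
  this returns the original function.  A face of \<open>F\<close> that misses a vertex of \<open>K\<close> lands in a face of
  \<open>Q\<^sup>m\<^sup>+\<^sup>1\<close> that does not contain \<open>T\<^sup>m\<close>, so there the result is zero.  The construction commutes with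
  restriction to smaller faces that contain \<open>K\<close>, hence it can be glued, with zero on the simplices
  that do not contain \<open>K\<close> (\<open>local_extension_operator_glue\<close>).  If \<open>K\<close> has the maximal dimension \<open>n\<close>,
  then there is no simplex above it in the complex, and extension by zero works.

  From local to simplicial operators.  A simplex of dimension \<open>n > m\<close> in the complex has a face \<open>G\<close>
  of dimension \<open>m + 1\<close>, which has a face \<open>K\<close> of dimension \<open>m\<close>.  The component at \<open>G\<close> of the local
  extension operator of \<open>K\<close> becomes \<open>E\<^sub>m\<close> after identifying \<open>G\<close> with \<open>Q\<^sup>m\<^sup>+\<^sup>1\<close> and \<open>K\<close> with \<open>T\<^sup>m\<close>.

  Both constructions conjugate an extension operator with pullbacks along vertex maps, and both are
  instances of \<open>extension_operator_transport\<close>.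
\<close>

section \<open>Faces of the hull of an affinely independent set\<close>

text \<open>
  Subtracting one point of \<open>C\<close> from the others turns affine into linear independence, and a linear map
  may be prescribed on an independent set.
\<close>

lemma affine_independent_extend:
  fixes C :: "'a::real_vector set" and f :: "'a \<Rightarrow> 'b::real_vector"
  assumes "\<not> affine_dependent C"
  obtains L c where "linear L" "\<And>v. v \<in> C \<Longrightarrow> L v + c = f v"
proof (cases "C = {}")
  case True
  then show ?thesis using that[of "\<lambda>x. 0" 0] by (simp add: module_hom_zero)
next
  case False
  then obtain a where a: "a \<in> C" by blast
  have ind: "independent ((\<lambda>x. - a + x) ` (C - {a}))"
    using assms affine_dependent_iff_dependent2[OF a] by blast
  obtain L where L: "linear L"
    and Leq: "\<forall>w\<in>(\<lambda>x. - a + x) ` (C - {a}). L w = f (a + w) - f a"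
    using linear_independent_extend[OF ind, of "\<lambda>w. f (a + w) - f a"] by blast
  have "L v + (f a - L a) = f v" if "v \<in> C" for v
  proof (cases "v = a")
    case False
    then have "L (- a + v) = f v - f a" using Leq that by force
    then show ?thesis using linear_diff[OF L, of v a] by (simp add: algebra_simps)
  qed simp
  then show ?thesis using that[OF L] by blast
qed

lemma affine_vimage_convex:
  assumes "linear L" "convex S"
  shows "convex {x. L x + c \<in> S}"
proof -
  have "{x. L x + c \<in> S} = L -` ((\<lambda>x. x - c) ` S)"
    by (auto simp: image_iff algebra_simps intro: bexI[of _ "L _ + c"])
  then show ?thesis
    using assms by (simp add: convex_linear_vimage convex_translation_subtract)
qed

lemma affine_maps_eq_on_convex_hull:
  assumes "linear L" "linear M" "\<And>v. v \<in> C \<Longrightarrow> L v + c = M v + d" "x \<in> convex hull C"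
  shows "L x + c = M x + d"
proof -
  have "convex {x. (\<lambda>x. L x - M x) x + (c - d) \<in> {0}}"
    by (rule affine_vimage_convex) (auto intro: linear_compose_sub assms)
  moreover have "C \<subseteq> {x. (\<lambda>x. L x - M x) x + (c - d) \<in> {0}}"
    using assms(3) by (auto simp: algebra_simps)
  ultimately have "convex hull C \<subseteq> {x. (\<lambda>x. L x - M x) x + (c - d) \<in> {0}}"
    by (rule hull_minimal[rotated])
  with assms(4) show ?thesis by (auto simp: algebra_simps)
qed

text \<open>
  The affine function that is \<open>0\<close> on \<open>D\<close> and \<open>1\<close> on the rest of \<open>C\<close> separates the affine hull of
  \<open>D\<close> from the hull of the other points.  This argument is valid in every real vector space, unlike
  those that go through dimension or relative interior.
\<close>

lemma convex_hull_subset_face_of: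
  fixes C :: "'a::real_vector set"
  assumes C: "finite C" "\<not> affine_dependent C" and "D \<subseteq> C"
  shows "convex hull D face_of convex hull C"
proof (rule face_of_convex_hulls[OF C(1) \<open>D \<subseteq> C\<close>])
  obtain L :: "'a \<Rightarrow> real" and c where L: "linear L"
    and Lc: "\<And>v. v \<in> C \<Longrightarrow> L v + c = (if v \<in> D then 0 else 1)"
    using affine_independent_extend[OF C(2), of "\<lambda>v. if v \<in> D then 0 else 1"] by blast
  have hull: "x \<in> affine hull S \<Longrightarrow> (\<And>v. v \<in> S \<Longrightarrow> L v + c = r) \<Longrightarrow> L x + c = r" for S r x
  proof -
    assume x: "x \<in> affine hull S" and eq: "\<And>v. v \<in> S \<Longrightarrow> L v + c = r"
    have "affine {x. L x + c = r}"
      unfolding affine_def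
    proof (intro ballI allI impI)
      fix x y :: 'a and u v :: real
      assume xy: "x \<in> {x. L x + c = r}" "y \<in> {x. L x + c = r}" and uv: "u + v = 1"
      have "L (u *\<^sub>R x + v *\<^sub>R y) + c = u * (L x + c) + v * (L y + c) + (1 - (u + v)) * c"
        by (simp add: linear_add[OF L] linear_scale[OF L] algebra_simps)
      also have "\<dots> = r" using xy uv by (simp flip: distrib_right)
      finally show "u *\<^sub>R x + v *\<^sub>R y \<in> {x. L x + c = r}" by simp
    qed
    then have "affine hull S \<subseteq> {x. L x + c = r}"
      using eq by (intro hull_minimal) auto
    with x show ?thesis by blast
  qed
  show "affine hull D \<inter> convex hull (C - D) = {}"
    using hull[of _ D 0] hull[of _ "C - D" 1] Lc \<open>D \<subseteq> C\<close>
      convex_hull_subset_affine_hull[of "C - D"] by fastforce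
qed

text \<open>
  A point of \<open>K\<close> is a convex combination of points of \<open>C\<close>.  It lies on a segment that starts at any
  point \<open>v\<close> of positive weight and ends at the normalized combination of the others, so the face
  property puts \<open>v\<close> into \<open>K\<close>.
\<close>

lemma face_of_convex_hull_finite:
  fixes C :: "'a::real_vector set"
  assumes C: "finite C" and K: "K face_of convex hull C"
  shows "K = convex hull (K \<inter> C)"
proof
  show "convex hull (K \<inter> C) \<subseteq> K"
    using K by (intro hull_minimal) (auto simp: face_of_def)
  show "K \<subseteq> convex hull (K \<inter> C)"
  proof
    fix x assume x: "x \<in> K"
    then have "x \<in> convex hull C" using K face_of_imp_subset by blast
    then obtain u where u: "\<And>v. v \<in> C \<Longrightarrow> 0 \<le> u v" "sum u C = 1" "(\<Sum>v\<in>C. u v *\<^sub>R v) = x"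
      unfolding convex_hull_finite[OF C] by blast
    have inK: "v \<in> K" if v: "v \<in> C" "u v \<noteq> 0" for v
    proof -
      \<comment> \<open>the normalized combination of the other points, so that \<open>x = u v v + (1 - u v) y\<close>\<close>
      define y where "y = (\<Sum>w\<in>C - {v}. (u w / (1 - u v)) *\<^sub>R w)"
      have rest: "sum u (C - {v}) = 1 - u v"
        using u(2) C v by (simp add: sum_diff1)
      have xeq: "x = u v *\<^sub>R v + (\<Sum>w\<in>C - {v}. u w *\<^sub>R w)"
        using u(3) C v by (simp add: sum.remove)
      show ?thesis
      proof (cases "u v = 1")
        case True
        then have "\<forall>w\<in>C - {v}. u w = 0"
          using rest C u(1) by (subst sum_nonneg_eq_0_iff[symmetric]) auto
        then show ?thesis using xeq True x by simp
      next
        case False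
        have "u v \<le> 1" using rest sum_nonneg[of "C - {v}" u] u(1) by simp
        with False v u(1)[of v] have uv: "0 < u v" "u v < 1" by auto
        have y: "y \<in> convex hull C"
          unfolding y_def
        proof (rule convex_sum)
          show "(\<Sum>w\<in>C - {v}. u w / (1 - u v)) = 1"
            using rest uv by (simp flip: sum_divide_distrib)
        qed (use C u(1) uv in \<open>auto simp: hull_inc\<close>)
        have "(1 - u v) *\<^sub>R y = (\<Sum>w\<in>C - {v}. u w *\<^sub>R w)"
          using uv unfolding y_def scaleR_sum_right by (intro sum.cong) auto
        then have xy: "x = u v *\<^sub>R v + (1 - u v) *\<^sub>R y" using xeq by simp
        show ?thesis
        proof (cases "v = y")
          case True
          then show ?thesis using xy x by (simp flip: scaleR_add_left)
        next
          case False
          have "x \<in> open_segment y v"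
            unfolding in_segment using False uv xy by (auto intro!: exI[of _ "u v"] simp: add.commute)
          then show ?thesis
            using face_ofD[OF K _ y _ x] v by (simp add: hull_inc)
        qed
      qed
    qed
    have "x = (\<Sum>v\<in>K \<inter> C. u v *\<^sub>R v)"
      unfolding u(3)[symmetric] using C inK by (intro sum.mono_neutral_right) auto
    moreover have "sum u (K \<inter> C) = 1"
      unfolding u(2)[symmetric] using C inK by (intro sum.mono_neutral_left) auto
    ultimately show "x \<in> convex hull (K \<inter> C)"
      using C u(1) by (auto simp: convex_hull_finite)
  qed
qed


section \<open>Simplices as vertex sets\<close>

lemma vertices_convex_hull:
  assumes "finite C" "\<not> affine_dependent C"
  shows "vertices (convex hull C) = C"
proof -
  have "v extreme_point_of convex hull C" if "v \<in> C" for v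
    using convex_hull_subset_face_of[OF assms, of "{v}"] that by (simp add: face_of_singleton)
  then show ?thesis
    by (auto simp: vertices_def dest: extreme_point_of_convex_hull)
qed

lemma simplexD:
  assumes "is_simplex F"
  shows "finite (vertices F)" "vertices F \<noteq> {}" "\<not> affine_dependent (vertices F)"
    "convex hull (vertices F) = F"
  using assms vertices_convex_hull by (auto simp: is_simplex_def)

lemma simplex_convex_hull:
  assumes "is_simplex F" "D \<subseteq> vertices F" "D \<noteq> {}"
  shows "is_simplex (convex hull D)" "vertices (convex hull D) = D"
proof -
  have "finite D" "\<not> affine_dependent D"
    using simplexD[OF assms(1)] assms(2) finite_subset affine_independent_subset by blast+
  then show "is_simplex (convex hull D)" "vertices (convex hull D) = D"
    using assms(3) vertices_convex_hull by (auto simp: is_simplex_def)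
qed

lemma convex_hull_face_le:
  assumes "is_simplex F" "D \<subseteq> vertices F" "D \<noteq> {}"
  shows "convex hull D \<unlhd> F"
  using convex_hull_subset_face_of[OF simplexD(1,3)[OF assms(1)] assms(2)] simplexD(4)[OF assms(1)] assms(3)
  by (auto simp: face_le_def)

lemma face_le_simplex:
  assumes "is_simplex F" "K \<unlhd> F"
  shows "is_simplex K" "vertices K \<subseteq> vertices F"
proof -
  let ?D = "K \<inter> vertices F"
  have K: "K = convex hull ?D"
    using face_of_convex_hull_finite[OF simplexD(1)[OF assms(1)]] simplexD(4)[OF assms(1)] assms(2)
    by (simp add: face_le_def)
  have "?D \<noteq> {}" using K assms(2) by (metis convex_hull_eq_empty face_le_def)
  then show "is_simplex K" "vertices K \<subseteq> vertices F"
    using simplex_convex_hull[OF assms(1), of ?D] K by auto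
qed

lemma card_vertices: "is_simplex F \<Longrightarrow> card (vertices F) = simplex_dim F + 1"
  using simplexD(1,2)[of F] card_gt_0_iff[of "vertices F"] by (simp add: simplex_dim_def)

text \<open>
  With this criterion and \<open>simplexD(4)\<close> all questions about faces of simplices become questions about
  finite sets of vertices.
\<close>

lemma face_le_iff_vertices:
  assumes "is_simplex K" "is_simplex F"
  shows "K \<unlhd> F \<longleftrightarrow> vertices K \<subseteq> vertices F"
  using face_le_simplex(2)[OF assms(2)] convex_hull_face_le[OF assms(2)] simplexD[OF assms(1)]
  by metis

lemma simplex_eq_iff_vertices:
  "is_simplex K \<Longrightarrow> is_simplex F \<Longrightarrow> K = F \<longleftrightarrow> vertices K = vertices F"
  by (metis simplexD(4))

lemma face_le_refl: "is_simplex F \<Longrightarrow> F \<unlhd> F"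
  by (simp add: face_le_iff_vertices)

lemma face_le_trans: "is_simplex F \<Longrightarrow> K \<unlhd> G \<Longrightarrow> G \<unlhd> F \<Longrightarrow> K \<unlhd> F"
  unfolding face_le_def using face_of_trans by blast

lemma face_less_iff_vertices:
  "is_simplex K \<Longrightarrow> is_simplex F \<Longrightarrow> K \<lhd>\<^sub>f F \<longleftrightarrow> vertices K \<subset> vertices F"
  by (auto simp: face_less_def face_le_iff_vertices simplex_eq_iff_vertices)

lemma lookup_scaleR [simp]:
  "Poly_Mapping.lookup (r *\<^sub>R x) i = r *\<^sub>R Poly_Mapping.lookup x i"
proof -
  have "finite {i. r *\<^sub>R Poly_Mapping.lookup x i \<noteq> 0}"
    by (rule finite_subset[of _ "{i. Poly_Mapping.lookup x i \<noteq> 0}"]) (auto simp: finite_lookup)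
  then show ?thesis by (simp add: scaleR_poly_mapping_def)
qed

lemma inj_basis_point: "inj basis_point"
proof (rule injI)
  fix i j assume "basis_point i = basis_point j"
  then have "Poly_Mapping.lookup (basis_point i) j = Poly_Mapping.lookup (basis_point j) j" by simp
  then show "i = j" by (simp add: basis_point_def lookup_single when_def split: if_splits)
qed

lemma independent_basis_points: "independent (basis_point ` A)"
proof -
  have look: "Poly_Mapping.lookup (\<Sum>i\<in>I. c i *\<^sub>R basis_point i) j = (if j \<in> I then c j else 0)"
    if "finite I" for I j and c :: "nat \<Rightarrow> real"
    using that
  proof (induction I)
    case (insert i I)
    have "Poly_Mapping.lookup (c i *\<^sub>R basis_point i) j = (if i = j then c i else 0)"
      by (simp add: basis_point_def lookup_single when_def)
    with insert show ?case by (auto simp: lookup_add)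
  qed simp
  show ?thesis
    unfolding independent_explicit_module
  proof (intro allI impI)
    fix t u v
    assume t: "finite t" "t \<subseteq> basis_point ` A" "(\<Sum>v\<in>t. u v *\<^sub>R v) = 0" "v \<in> t"
    obtain I where I: "t = basis_point ` I" "finite I"
      using t finite_subset_image by metis
    have "(\<Sum>i\<in>I. u (basis_point i) *\<^sub>R basis_point i) = 0"
      using t(3) I by (simp add: sum.reindex inj_on_subset[OF inj_basis_point])
    moreover obtain j where "j \<in> I" "v = basis_point j" using t(4) I by blast
    ultimately show "u v = 0"
      using look[OF I(2), of "\<lambda>i. u (basis_point i)" j] by simp
  qed
qed

lemma basis_point_nonzero: "basis_point i \<noteq> 0"
  by (metis basis_point_def lookup_single_eq lookup_zero zero_neq_one)

lemma affine_independent_insert_zero: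
  assumes "independent B"
  shows "\<not> affine_dependent (insert 0 B)"
proof -
  have "0 \<notin> B" using assms dependent_zero by blast
  then show ?thesis using assms affine_dependent_iff_dependent[of 0 B] by simp
qed

lemma Q_simplex:
  "is_simplex (Q_simplex d)" "vertices (Q_simplex d) = insert 0 (basis_point ` {0..<d})"
proof -
  have "\<not> affine_dependent (insert 0 (basis_point ` {0..<d}))"
    using affine_independent_insert_zero independent_basis_points by blast
  from vertices_convex_hull[OF _ this] this
  show "is_simplex (Q_simplex d)" "vertices (Q_simplex d) = insert 0 (basis_point ` {0..<d})"
    unfolding is_simplex_def Q_simplex_def
    by (auto intro!: exI[of _ "insert 0 (basis_point ` {0..<d})"])
qed

lemma T_simplex:
  "is_simplex (T_simplex m)" "vertices (T_simplex m) = basis_point ` {0..m}"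
    "T_simplex m \<unlhd> Q_simplex (m + 1)"
proof -
  have D: "basis_point ` {0..m} \<subseteq> vertices (Q_simplex (m + 1))" "basis_point ` {0..m} \<noteq> {}"
    using Q_simplex(2) by auto
  show "is_simplex (T_simplex m)" "vertices (T_simplex m) = basis_point ` {0..m}"
    "T_simplex m \<unlhd> Q_simplex (m + 1)"
    unfolding T_simplex_def
    using simplex_convex_hull[OF Q_simplex(1) D] convex_hull_face_le[OF Q_simplex(1) D] by auto
qed

lemma vertices_Q_simplex_Suc:
  "vertices (Q_simplex (m + 1)) = insert 0 (vertices (T_simplex m))"
  unfolding Q_simplex(2) T_simplex(2) by (simp add: atLeastLessThanSuc_atLeastAtMost)

lemma card_vertices_T_simplex: "card (vertices (T_simplex m)) = m + 1"
  unfolding T_simplex(2) by (simp add: card_image inj_on_subset[OF inj_basis_point])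


section \<open>Simplicial maps as vertex maps\<close>

text \<open>
  The value off \<open>F\<close> is pinned to \<open>undefined\<close> because that is how maps out of \<open>F\<close> are represented;
  it makes the map unique, so that equality of simplicial maps can be checked on vertices.
\<close>

definition affine_ext :: "point set \<Rightarrow> (point \<Rightarrow> point) \<Rightarrow> point \<Rightarrow> point" where
  "affine_ext F f =
     (SOME \<Phi>. \<Phi> \<in> extensional F \<and> affine_fun_on F \<Phi> \<and> (\<forall>v\<in>vertices F. \<Phi> v = f v))"

lemma simplex_vertices_subset: "is_simplex F \<Longrightarrow> vertices F \<subseteq> F"
  using hull_subset[of "vertices F" convex] simplexD(4)[of F] by simp

lemma affine_ext:
  assumes "is_simplex F"
  shows "affine_ext F f \<in> extensional F" "affine_fun_on F (affine_ext F f)"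
    "\<And>v. v \<in> vertices F \<Longrightarrow> affine_ext F f v = f v"
proof -
  obtain L c where "linear L" "\<And>v. v \<in> vertices F \<Longrightarrow> L v + c = f v"
    using affine_independent_extend[OF simplexD(3)[OF assms]] by blast
  then have "(\<lambda>x\<in>F. L x + c) \<in> extensional F \<and> affine_fun_on F (\<lambda>x\<in>F. L x + c)
      \<and> (\<forall>v\<in>vertices F. (\<lambda>x\<in>F. L x + c) v = f v)"
    using simplex_vertices_subset[OF assms] by (auto simp: affine_fun_on_def)
  then have "\<exists>\<Phi>. \<Phi> \<in> extensional F \<and> affine_fun_on F \<Phi> \<and> (\<forall>v\<in>vertices F. \<Phi> v = f v)"
    by blast
  then have "affine_ext F f \<in> extensional F \<and> affine_fun_on F (affine_ext F f)
      \<and> (\<forall>v\<in>vertices F. affine_ext F f v = f v)"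
    unfolding affine_ext_def by (rule someI_ex)
  then show "affine_ext F f \<in> extensional F" "affine_fun_on F (affine_ext F f)"
    "\<And>v. v \<in> vertices F \<Longrightarrow> affine_ext F f v = f v" by blast+
qed

lemma affine_ext_unique:
  assumes F: "is_simplex F" and "\<Phi> \<in> extensional F" and "affine_fun_on F \<Phi>"
    and eq: "\<And>v. v \<in> vertices F \<Longrightarrow> \<Phi> v = f v"
  shows "\<Phi> = affine_ext F f"
proof (rule extensionalityI[of _ F])
  obtain L c where L: "linear L" "\<forall>x\<in>F. \<Phi> x = L x + c"
    using assms by (auto simp: affine_fun_on_def)
  obtain M d where M: "linear M" "\<forall>x\<in>F. affine_ext F f x = M x + d"
    using affine_ext(2)[OF F, of f] unfolding affine_fun_on_def by blast
  have "L v + c = M v + d" if "v \<in> vertices F" for v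
  proof -
    have "v \<in> F" using that simplex_vertices_subset[OF F] by blast
    then show ?thesis using L(2) M(2) eq[OF that] affine_ext(3)[OF F that, of f] by simp
  qed
  then show "\<Phi> x = affine_ext F f x" if "x \<in> F" for x
    using affine_maps_eq_on_convex_hull[OF L(1) M(1), of "vertices F" c d x] simplexD(4)[OF F]
      L(2) M(2) that by simp
qed (use assms affine_ext(1) in auto)

lemma simplicial_map_affine_ext:
  assumes F: "is_simplex F" and G: "is_simplex G" and f: "f ` vertices F \<subseteq> vertices G"
  shows "simplicial_map F G (affine_ext F f)"
proof -
  obtain L c where L: "linear L" "\<forall>x\<in>F. affine_ext F f x = L x + c"
    using affine_ext(2)[OF F, of f] unfolding affine_fun_on_def by blast
  have "convex {x. L x + c \<in> G}"
    using affine_vimage_convex[OF L(1), of G] simplexD(4)[OF G] convex_convex_hull[of "vertices G"] by simp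
  moreover have "vertices F \<subseteq> {x. L x + c \<in> G}"
  proof
    fix v assume v: "v \<in> vertices F"
    have "v \<in> F" using v simplex_vertices_subset[OF F] by blast
    then have "L v + c = f v" using L(2) affine_ext(3)[OF F v, of f] by simp
    then show "v \<in> {x. L x + c \<in> G}" using f v simplex_vertices_subset[OF G] by auto
  qed
  ultimately have "convex hull vertices F \<subseteq> {x. L x + c \<in> G}" by (rule hull_minimal[rotated])
  then have "F \<subseteq> {x. L x + c \<in> G}" using simplexD(4)[OF F] by simp
  then show ?thesis
    using affine_ext(1,2)[OF F, of f] affine_ext(3)[OF F, of _ f] L(2) f by (auto simp: simplicial_map_def PiE_def)
qed

text \<open>
  Together with the next lemma, this says that passing from vertex maps to simplicial maps is
  functorial.
\<close>

lemma compose_affine_ext: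
  assumes F: "is_simplex F" and G: "is_simplex G" and f: "f ` vertices F \<subseteq> vertices G"
  shows "compose F (affine_ext G g) (affine_ext F f) = affine_ext F (g \<circ> f)"
proof (rule affine_ext_unique[OF F])
  have map: "x \<in> F \<Longrightarrow> affine_ext F f x \<in> G" for x
    using simplicial_map_affine_ext[OF assms] by (auto simp: simplicial_map_def)
  obtain L c where L: "linear L" "\<forall>x\<in>F. affine_ext F f x = L x + c"
    using affine_ext(2)[OF F, of f] unfolding affine_fun_on_def by blast
  obtain M d where M: "linear M" "\<forall>x\<in>G. affine_ext G g x = M x + d"
    using affine_ext(2)[OF G, of g] unfolding affine_fun_on_def by blast
  have "compose F (affine_ext G g) (affine_ext F f) x = (M \<circ> L) x + (M c + d)" if "x \<in> F" for x
    using that map[OF that] L(2) M(2) linear_add[OF M(1)] by (simp add: compose_def add.assoc)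
  then show "affine_fun_on F (compose F (affine_ext G g) (affine_ext F f))"
    unfolding affine_fun_on_def using linear_compose[OF L(1) M(1)] by blast
  show "compose F (affine_ext G g) (affine_ext F f) v = (g \<circ> f) v" if "v \<in> vertices F" for v
    using that simplex_vertices_subset[OF F] affine_ext(3)[OF F that]
      affine_ext(3)[OF G, of "f v"] f by (auto simp: compose_def)
qed simp

lemma restrict_id_affine_ext:
  assumes "is_simplex F"
  shows "(\<lambda>x\<in>F. x) = affine_ext F id"
proof (rule affine_ext_unique[OF assms])
  show "affine_fun_on F (\<lambda>x\<in>F. x)"
    unfolding affine_fun_on_def by (intro exI[of _ id] exI[of _ 0]) (simp add: linear_id)
qed (use simplex_vertices_subset[OF assms] in auto)

lemma affine_ext_cong:
  assumes "is_simplex F" "\<And>v. v \<in> vertices F \<Longrightarrow> f v = g v"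
  shows "affine_ext F f = affine_ext F g"
  using affine_ext_unique[OF assms(1) affine_ext(1,2)[OF assms(1)], of f g]
  by (simp add: affine_ext(3)[OF assms(1)] assms(2))


section \<open>Linear maps\<close>

lemma linear_map_closed: "linear_map k V W f \<Longrightarrow> x \<in> carrier V \<Longrightarrow> f x \<in> carrier W"
  by (auto simp: linear_map_def)

lemma linear_map_compose:
  "linear_map k V W f \<Longrightarrow> linear_map k W X g \<Longrightarrow> linear_map k V X (g \<circ> f)"
  by (auto simp: linear_map_def Pi_iff)

lemma linear_map_zero:
  assumes V: "Module.module k V" and W: "Module.module k W" and f: "linear_map k V W f"
  shows "f \<zero>\<^bsub>V\<^esub> = \<zero>\<^bsub>W\<^esub>"
proof -
  interpret V: Module.module k V by fact
  interpret W: Module.module k W by fact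
  have "f \<zero>\<^bsub>V\<^esub> = f (\<zero>\<^bsub>k\<^esub> \<odot>\<^bsub>V\<^esub> \<zero>\<^bsub>V\<^esub>)" by simp
  also have "\<dots> = \<zero>\<^bsub>k\<^esub> \<odot>\<^bsub>W\<^esub> f \<zero>\<^bsub>V\<^esub>"
    using f V.R.zero_closed V.M.zero_closed unfolding linear_map_def by blast
  also have "\<dots> = \<zero>\<^bsub>W\<^esub>" using linear_map_closed[OF f] by simp
  finally show ?thesis .
qed


section \<open>Pullback along vertex maps\<close>

definition vertex_map :: "point set \<Rightarrow> point set \<Rightarrow> (point \<Rightarrow> point) \<Rightarrow> bool" where
  "vertex_map F G f \<longleftrightarrow> is_simplex F \<and> is_simplex G \<and> f ` vertices F \<subseteq> vertices G"

lemma vertex_map_face: "K \<unlhd> F \<Longrightarrow> vertex_map F G f \<Longrightarrow> vertex_map K G f"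
  using face_le_simplex[of F K] by (auto simp: vertex_map_def)

lemma vertex_map_inclusion: "is_simplex F \<Longrightarrow> K \<unlhd> F \<Longrightarrow> vertex_map K F id"
  using face_le_simplex[of F K] by (auto simp: vertex_map_def)

context simplicial_function_space
begin

abbreviation vanishing :: "point set \<Rightarrow> ('k, 'v) module" where
  "vanishing \<equiv> vanishing_trace \<F> pull"

lemma vanishing_iff:
  "\<phi> \<in> carrier (vanishing K) \<longleftrightarrow>
     \<phi> \<in> carrier (\<F> K) \<and> (\<forall>S. S \<lhd>\<^sub>f K \<longrightarrow> tr pull K S \<phi> = \<zero>\<^bsub>\<F> S\<^esub>)"
  by (auto simp: vanishing_trace_def)

definition vpull :: "point set \<Rightarrow> point set \<Rightarrow> (point \<Rightarrow> point) \<Rightarrow> 'v \<Rightarrow> 'v" where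
  "vpull F G f = pull F G (affine_ext F f)"

lemma vpull_linear: "vertex_map F G f \<Longrightarrow> linear_map k (\<F> G) (\<F> F) (vpull F G f)"
  unfolding vpull_def vertex_map_def by (intro pull_linear simplicial_map_affine_ext) auto

lemma vpull_closed: "vertex_map F G f \<Longrightarrow> \<phi> \<in> carrier (\<F> G) \<Longrightarrow> vpull F G f \<phi> \<in> carrier (\<F> F)"
  using vpull_linear linear_map_closed by metis

lemma vpull_zero: "vertex_map F G f \<Longrightarrow> vpull F G f \<zero>\<^bsub>\<F> G\<^esub> = \<zero>\<^bsub>\<F> F\<^esub>"
  using linear_map_zero vpull_linear vector_space by (metis vertex_map_def)

lemma vpull_comp:
  assumes "vertex_map F G f" "vertex_map G H g" "\<phi> \<in> carrier (\<F> H)"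
  shows "vpull F G f (vpull G H g \<phi>) = vpull F H (g \<circ> f) \<phi>"
proof -
  have s: "is_simplex F" "is_simplex G" "is_simplex H" "f ` vertices F \<subseteq> vertices G"
    "g ` vertices G \<subseteq> vertices H" using assms by (auto simp: vertex_map_def)
  show ?thesis
    unfolding vpull_def compose_affine_ext[OF s(1,2,4), symmetric]
    using pull_comp[OF s(1,2,3) simplicial_map_affine_ext[OF s(1,2,4)]
        simplicial_map_affine_ext[OF s(2,3,5)] assms(3)] by simp
qed

lemma vpull_cong:
  "is_simplex F \<Longrightarrow> (\<And>v. v \<in> vertices F \<Longrightarrow> f v = g v) \<Longrightarrow> vpull F G f = vpull F G g"
  unfolding vpull_def using affine_ext_cong[of F f g] by simp

lemma tr_eq_vpull: "is_simplex K \<Longrightarrow> tr pull F K = vpull K F id"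
  by (simp add: tr_def vpull_def restrict_id_affine_ext)

lemma vpull_id:
  assumes "is_simplex F" "\<And>v. v \<in> vertices F \<Longrightarrow> f v = v" "\<phi> \<in> carrier (\<F> F)"
  shows "vpull F F f \<phi> = \<phi>"
proof -
  have "vpull F F f = vpull F F id" using assms by (intro vpull_cong) auto
  then show ?thesis
    using pull_id[OF assms(1,3)] by (simp add: vpull_def restrict_id_affine_ext[OF assms(1)])
qed

lemma tr_vpull:
  assumes "vertex_map F G f" "K \<unlhd> F" "\<phi> \<in> carrier (\<F> G)"
  shows "tr pull F K (vpull F G f \<phi>) = vpull K G f \<phi>"
proof -
  have F: "is_simplex F" using assms by (simp add: vertex_map_def)
  show ?thesis
    using vpull_comp[OF vertex_map_inclusion[OF F assms(2)] assms(1,3)]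
    by (simp add: tr_eq_vpull[OF face_le_simplex(1)[OF F assms(2)]])
qed

lemma vpull_tr:
  assumes "vertex_map F K f" "is_simplex G" "K \<unlhd> G" "\<phi> \<in> carrier (\<F> G)"
  shows "vpull F K f (tr pull G K \<phi>) = vpull F G f \<phi>"
  using vpull_comp[OF assms(1) vertex_map_inclusion[OF assms(2,3)] assms(4)]
  by (simp add: tr_eq_vpull[OF face_le_simplex(1)[OF assms(2,3)]])

text \<open>
  The map factors through the face of \<open>G\<close> spanned by the image of the vertices of \<open>F\<close>, and hence so
  does the pullback.
\<close>

lemma vpull_eq_zero_if_tr_image_zero:
  assumes f: "vertex_map F G f" and \<phi>: "\<phi> \<in> carrier (\<F> G)"
    and zero: "tr pull G (convex hull (f ` vertices F)) \<phi> = \<zero>\<^bsub>\<F> (convex hull (f ` vertices F))\<^esub>"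
  shows "vpull F G f \<phi> = \<zero>\<^bsub>\<F> F\<^esub>"
proof -
  let ?S = "convex hull (f ` vertices F)"
  have s: "is_simplex F" "is_simplex G" "f ` vertices F \<subseteq> vertices G" "f ` vertices F \<noteq> {}"
    using f simplexD(2) by (auto simp: vertex_map_def)
  have "vertex_map F ?S f"
    using simplex_convex_hull[OF s(2-4)] s(1) by (simp add: vertex_map_def)
  then show ?thesis
    using vpull_tr[OF _ s(2) convex_hull_face_le[OF s(2-4)] \<phi>, of F f] vpull_zero zero by metis
qed

text \<open>
  A bijection of vertices takes proper faces to proper faces.
\<close>

lemma vpull_vanishing:
  assumes g: "vertex_map T K g" and bij: "bij_betw g (vertices T) (vertices K)"
    and \<phi>: "\<phi> \<in> carrier (vanishing K)"
  shows "vpull T K g \<phi> \<in> carrier (vanishing T)"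
proof -
  have s: "is_simplex T" "is_simplex K" using g by (auto simp: vertex_map_def)
  have \<phi>K: "\<phi> \<in> carrier (\<F> K)" using \<phi> vanishing_iff by blast
  have "tr pull T S (vpull T K g \<phi>) = \<zero>\<^bsub>\<F> S\<^esub>" if S: "S \<lhd>\<^sub>f T" for S
  proof -
    have ST: "S \<unlhd> T" "is_simplex S" using S face_le_simplex(1)[OF s(1)] by (auto simp: face_less_def)
    let ?D = "g ` vertices S"
    have "vertices S \<subset> vertices T" using S face_less_iff_vertices[OF ST(2) s(1)] by blast
    then have D: "?D \<subset> vertices K"
      using bij by (metis bij_betw_def image_strict_mono)
    have hull: "is_simplex (convex hull ?D)" "vertices (convex hull ?D) = ?D"
      using simplex_convex_hull[OF s(2), of ?D] D simplexD(2)[OF ST(2)] by auto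
    then have "convex hull ?D \<lhd>\<^sub>f K"
      using D face_less_iff_vertices[OF hull(1) s(2)] by simp
    then have "tr pull K (convex hull ?D) \<phi> = \<zero>\<^bsub>\<F> (convex hull ?D)\<^esub>"
      using \<phi> vanishing_iff by blast
    then show ?thesis
      unfolding tr_vpull[OF g ST(1) \<phi>K]
      by (rule vpull_eq_zero_if_tr_image_zero[OF vertex_map_face[OF ST(1) g] \<phi>K])
  qed
  then show ?thesis
    using vpull_closed[OF g \<phi>K] vanishing_iff by blast
qed


section \<open>Extension operators from a face to a simplex\<close>

text \<open>
  The common form of the simplicial extension operators and of the components of local ones.
\<close>

definition extension_operator :: "point set \<Rightarrow> point set \<Rightarrow> ('v \<Rightarrow> 'v) \<Rightarrow> bool" where
  "extension_operator K G E \<longleftrightarrow>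
     linear_map k (vanishing K) (\<F> G) E \<and>
     (\<forall>\<phi> \<in> carrier (vanishing K).
        tr pull G K (E \<phi>) = \<phi> \<and>
        (\<forall>S. S \<unlhd> G \<and> \<not> K \<unlhd> S \<longrightarrow> tr pull G S (E \<phi>) = \<zero>\<^bsub>\<F> S\<^esub>))"

lemma extension_operatorD:
  assumes "extension_operator K G E" "\<phi> \<in> carrier (vanishing K)"
  shows "E \<phi> \<in> carrier (\<F> G)" "tr pull G K (E \<phi>) = \<phi>"
    "\<And>S. S \<unlhd> G \<Longrightarrow> \<not> K \<unlhd> S \<Longrightarrow> tr pull G S (E \<phi>) = \<zero>\<^bsub>\<F> S\<^esub>"
  using assms linear_map_closed[of k "vanishing K" "\<F> G" E \<phi>] by (simp_all add: extension_operator_def)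

lemma simplicial_extension_operator_iff:
  "simplicial_extension_operator k \<F> pull m E \<longleftrightarrow>
     extension_operator (T_simplex m) (Q_simplex (m + 1)) E"
  unfolding simplicial_extension_operator_def extension_operator_def ..

text \<open>
  This lemma carries both directions of the theorem.  Take a vertex map \<open>f : F \<rightarrow> G\<close> that matches the
  vertices of \<open>K'\<close> with those of \<open>K\<close> and sends no other vertex into \<open>K\<close>.  Then an extension operator
  from \<open>K\<close> to \<open>G\<close> can be conjugated into one from \<open>K'\<close> to \<open>F\<close>: a face of \<open>F\<close> that misses a vertex
  of \<open>K'\<close> is mapped into a face of \<open>G\<close> that misses a vertex of \<open>K\<close>, where the extension is zero.
  The map \<open>f\<close> may collapse the other vertices.  Since only the last pullback depends on \<open>F\<close>, the
  operators obtained for the faces of \<open>F\<close> are the traces of the one for \<open>F\<close>.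
\<close>

lemma extension_operator_transport:
  assumes E: "extension_operator K G E" and KG: "K \<unlhd> G" and K'F: "K' \<unlhd> F"
    and f: "vertex_map F G f" and bij: "bij_betw f (vertices K') (vertices K)"
    and pre: "\<And>v. v \<in> vertices F \<Longrightarrow> f v \<in> vertices K \<Longrightarrow> v \<in> vertices K'"
  defines "e S \<equiv> vpull S G f \<circ> E \<circ> vpull K K' (inv_into (vertices K') f)"
  shows "extension_operator K' F (e F)"
    and "\<And>S \<phi>. S \<unlhd> F \<Longrightarrow> \<phi> \<in> carrier (vanishing K') \<Longrightarrow> tr pull F S (e F \<phi>) = e S \<phi>"
proof -
  let ?g = "inv_into (vertices K') f"
  have F: "is_simplex F" and G: "is_simplex G" using f by (auto simp: vertex_map_def)
  have K: "is_simplex K" and K': "is_simplex K'" using face_le_simplex(1) F G KG K'F by blast+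
  have bijg: "bij_betw ?g (vertices K) (vertices K')" using bij by (rule bij_betw_inv_into)
  have g: "vertex_map K K' ?g" using K K' bijg by (auto simp: vertex_map_def bij_betw_def)
  have gf: "?g (f v) = v" if "v \<in> vertices K'" for v
    using bij that by (simp add: bij_betw_inv_into_left)
  have fK: "vertex_map K' K f" using K K' bij by (auto simp: vertex_map_def bij_betw_def)
  have lin_g: "linear_map k (vanishing K') (vanishing K) (vpull K K' ?g)"
    using vpull_linear[OF g] vpull_vanishing[OF g bijg] 
    by (auto simp: linear_map_def vanishing_trace_def)
  have lin: "linear_map k (vanishing K') (\<F> F) (e F)"
    unfolding e_def
    using linear_map_compose[OF linear_map_compose[OF lin_g] vpull_linear[OF f]] E
    by (simp add: extension_operator_def comp_assoc)
  have E\<psi>: "E (vpull K K' ?g \<phi>) \<in> carrier (\<F> G)" and \<psi>: "vpull K K' ?g \<phi> \<in> carrier (vanishing K)"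
    if "\<phi> \<in> carrier (vanishing K')" for \<phi>
    using vpull_vanishing[OF g bijg that] extension_operatorD(1)[OF E] by blast+
  show tr_e: "tr pull F S (e F \<phi>) = e S \<phi>"
    if "S \<unlhd> F" "\<phi> \<in> carrier (vanishing K')" for S \<phi>
    unfolding e_def using tr_vpull[OF f that(1) E\<psi>[OF that(2)]] by simp
  have ext: "tr pull F K' (e F \<phi>) = \<phi>"
    and van: "S \<unlhd> F \<Longrightarrow> \<not> K' \<unlhd> S \<Longrightarrow> tr pull F S (e F \<phi>) = \<zero>\<^bsub>\<F> S\<^esub>"
    if \<phi>: "\<phi> \<in> carrier (vanishing K')" for \<phi> S
  proof -
    let ?\<psi> = "vpull K K' ?g \<phi>"
    note E\<psi> = E\<psi>[OF \<phi>] and \<psi> = \<psi>[OF \<phi>]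
    have \<phi>K': "\<phi> \<in> carrier (\<F> K')" using \<phi> vanishing_iff by blast
    have "tr pull F K' (e F \<phi>) = vpull K' G f (E ?\<psi>)"
      unfolding tr_e[OF K'F \<phi>] by (simp add: e_def)
    also have "\<dots> = vpull K' K f (tr pull G K (E ?\<psi>))"
      by (rule vpull_tr[OF fK G KG E\<psi>, symmetric])
    also have "\<dots> = vpull K' K f ?\<psi>"
      by (simp add: extension_operatorD(2)[OF E \<psi>])
    also have "\<dots> = vpull K' K' (?g \<circ> f) \<phi>"
      by (rule vpull_comp[OF fK g \<phi>K'])
    also have "\<dots> = \<phi>"
      using gf by (intro vpull_id[OF K' _ \<phi>K']) simp
    finally show "tr pull F K' (e F \<phi>) = \<phi>" .
    assume S: "S \<unlhd> F" "\<not> K' \<unlhd> S"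
    have Ss: "is_simplex S" "vertices S \<subseteq> vertices F" using face_le_simplex[OF F S(1)] by auto
    let ?D = "f ` vertices S"
    have D: "?D \<subseteq> vertices G" "?D \<noteq> {}"
      using f Ss simplexD(2)[OF Ss(1)] by (auto simp: vertex_map_def)
    have "\<not> vertices K \<subseteq> ?D"
    proof
      assume sub: "vertices K \<subseteq> ?D"
      have "v \<in> vertices S" if v: "v \<in> vertices K'" for v
      proof -
        have fv: "f v \<in> vertices K" using bij v by (auto simp: bij_betw_def)
        then obtain w where w: "w \<in> vertices S" "f v = f w" using sub by blast
        then have "w \<in> vertices K'" using pre[of w] Ss fv by auto
        then have "v = w" using bij v w by (auto simp: bij_betw_def inj_on_def)
        then show ?thesis using w by simp
      qed
      then show False using S(2) face_le_iff_vertices[OF K' Ss(1)] by blast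
    qed
    then have "\<not> K \<unlhd> convex hull ?D"
      using simplex_convex_hull[OF G D] face_le_iff_vertices[OF K] by simp
    then have "tr pull G (convex hull ?D) (E ?\<psi>) = \<zero>\<^bsub>\<F> (convex hull ?D)\<^esub>"
      by (rule extension_operatorD(3)[OF E \<psi> convex_hull_face_le[OF G D]])
    then show "tr pull F S (e F \<phi>) = \<zero>\<^bsub>\<F> S\<^esub>"
      unfolding tr_e[OF S(1) \<phi>] unfolding e_def comp_apply
      by (rule vpull_eq_zero_if_tr_image_zero[OF vertex_map_face[OF S(1) f] E\<psi>])
  qed
  show "extension_operator K' F (e F)"
    unfolding extension_operator_def using lin ext van by simp
qed

text \<open>
  The case of a simplex of maximal dimension, above which there is nothing to extend to.
\<close>

lemma extension_operator_inclusion: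
  assumes "is_simplex K"
  shows "extension_operator K K (\<lambda>\<phi>. \<phi>)"
  unfolding extension_operator_def
proof (intro conjI ballI allI impI)
  show "linear_map k (vanishing K) (\<F> K) (\<lambda>\<phi>. \<phi>)"
    by (auto simp: linear_map_def vanishing_trace_def)
next
  fix \<phi> assume "\<phi> \<in> carrier (vanishing K)"
  then show "tr pull K K \<phi> = \<phi>"
    using pull_id[OF assms] vanishing_iff by (simp add: tr_def)
next
  fix \<phi> S assume "\<phi> \<in> carrier (vanishing K)" "S \<unlhd> K \<and> \<not> K \<unlhd> S"
  then show "tr pull K S \<phi> = \<zero>\<^bsub>\<F> S\<^esub>"
    using vanishing_iff[of \<phi> K] face_le_refl[OF assms] by (auto simp: face_less_def)
qed


section \<open>Local extension operators\<close>

lemma local_extension_operator_restrict: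
  assumes T: "is_simplicial_complex \<TT>" and E: "local_extension_operator k \<F> pull \<TT> K E"
    and G: "G \<in> \<TT>" and KG: "K \<unlhd> G"
  shows "extension_operator K G (\<lambda>\<phi>. E \<phi> G)"
proof -
  have closed: "S \<in> \<TT>" if "S \<unlhd> G" for S
    using T G that by (auto simp: is_simplicial_complex_def)
  have lin: "linear_map k (vanishing K) (global_space \<F> pull \<TT>) E"
    using E by (simp add: local_extension_operator_def)
  have glob: "E \<phi> G \<in> carrier (\<F> G)" "\<And>S. S \<unlhd> G \<Longrightarrow> tr pull G S (E \<phi> G) = E \<phi> S"
    if "\<phi> \<in> carrier (vanishing K)" for \<phi>
    using linear_map_closed[OF lin that] G closed by (auto simp: global_space_def PiE_iff)
  have "linear_map k (vanishing K) (\<F> G) (\<lambda>\<phi>. E \<phi> G)"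
    using lin glob(1) G by (auto simp: linear_map_def global_space_def)
  then show ?thesis
    using E KG closed glob(2)
    by (auto simp: extension_operator_def local_extension_operator_def global_trace_def)
qed

text \<open>
  Compatibility on the faces that contain \<open>K\<close> suffices: a face of \<open>F\<close> that does not contain \<open>K\<close>
  gets trace zero because \<open>e F\<close> is an extension operator, or because \<open>F\<close> does not contain \<open>K\<close> either.
\<close>

lemma local_extension_operator_glue:
  assumes T: "is_simplicial_complex \<TT>" and K: "K \<in> \<TT>"
    and e: "\<And>F. F \<in> \<TT> \<Longrightarrow> K \<unlhd> F \<Longrightarrow> extension_operator K F (e F)"
    and compat: "\<And>F S \<phi>. \<lbrakk>F \<in> \<TT>; S \<unlhd> F; K \<unlhd> S; \<phi> \<in> carrier (vanishing K)\<rbrakk>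
      \<Longrightarrow> tr pull F S (e F \<phi>) = e S \<phi>"
  shows "local_extension_operator k \<F> pull \<TT> K
           (\<lambda>\<phi>. \<lambda>F\<in>\<TT>. if K \<unlhd> F then e F \<phi> else \<zero>\<^bsub>\<F> F\<^esub>)"
proof -
  let ?E = "\<lambda>\<phi>. \<lambda>F\<in>\<TT>. if K \<unlhd> F then e F \<phi> else \<zero>\<^bsub>\<F> F\<^esub>"
  have simp: "is_simplex F" if "F \<in> \<TT>" for F
    using T that by (simp add: is_simplicial_complex_def)
  have mod: "Module.module k (\<F> F)" if "F \<in> \<TT>" for F
    using vector_space simp that by blast
  have zero: "\<zero>\<^bsub>\<F> F\<^esub> \<in> carrier (\<F> F)" "\<zero>\<^bsub>\<F> F\<^esub> \<oplus>\<^bsub>\<F> F\<^esub> \<zero>\<^bsub>\<F> F\<^esub> = \<zero>\<^bsub>\<F> F\<^esub>"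
    "\<And>a. a \<in> carrier k \<Longrightarrow> a \<odot>\<^bsub>\<F> F\<^esub> \<zero>\<^bsub>\<F> F\<^esub> = \<zero>\<^bsub>\<F> F\<^esub>" if "F \<in> \<TT>" for F
  proof -
    interpret Module.module k "\<F> F" by (rule mod[OF that])
    show "\<zero>\<^bsub>\<F> F\<^esub> \<in> carrier (\<F> F)" "\<zero>\<^bsub>\<F> F\<^esub> \<oplus>\<^bsub>\<F> F\<^esub> \<zero>\<^bsub>\<F> F\<^esub> = \<zero>\<^bsub>\<F> F\<^esub>"
      "\<And>a. a \<in> carrier k \<Longrightarrow> a \<odot>\<^bsub>\<F> F\<^esub> \<zero>\<^bsub>\<F> F\<^esub> = \<zero>\<^bsub>\<F> F\<^esub>"
      by auto
  qed
  have lin: "linear_map k (vanishing K) (\<F> F) (e F)" if "F \<in> \<TT>" "K \<unlhd> F" for F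
    using e[OF that] by (simp add: extension_operator_def)
  have "?E \<phi> \<in> carrier (global_space \<F> pull \<TT>)" if \<phi>: "\<phi> \<in> carrier (vanishing K)" for \<phi>
  proof -
    have "tr pull F S (?E \<phi> F) = ?E \<phi> S" if FS: "F \<in> \<TT>" "S \<in> \<TT>" "S \<unlhd> F" for F S
    proof -
      consider "K \<unlhd> S" "K \<unlhd> F" | "\<not> K \<unlhd> S" "K \<unlhd> F" | "\<not> K \<unlhd> S" "\<not> K \<unlhd> F"
        using face_le_trans[OF simp[OF FS(1)] _ FS(3)] by blast
      then show ?thesis
      proof cases
        case 1
        then show ?thesis using FS compat \<phi> by simp
      next
        case 2
        then show ?thesis using FS extension_operatorD(3)[OF e[OF FS(1)] \<phi>] by simp
      next
        case 3
        then show ?thesis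
          using FS vpull_zero[OF vertex_map_inclusion[OF simp[OF FS(1)] FS(3)]]
          by (simp add: tr_eq_vpull simp)
      qed
    qed
    then show ?thesis
      using linear_map_closed[OF lin \<phi>] zero(1) by (auto simp: global_space_def)
  qed
  moreover have "?E (\<phi> \<oplus>\<^bsub>vanishing K\<^esub> \<psi>) = ?E \<phi> \<oplus>\<^bsub>global_space \<F> pull \<TT>\<^esub> ?E \<psi>"
    if "\<phi> \<in> carrier (vanishing K)" "\<psi> \<in> carrier (vanishing K)" for \<phi> \<psi>
    using lin zero(2) that by (auto simp: global_space_def linear_map_def fun_eq_iff)
  moreover have "?E (a \<odot>\<^bsub>vanishing K\<^esub> \<phi>) = a \<odot>\<^bsub>global_space \<F> pull \<TT>\<^esub> ?E \<phi>"
    if "a \<in> carrier k" "\<phi> \<in> carrier (vanishing K)" for a \<phi>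
    using lin zero(3) that by (auto simp: global_space_def linear_map_def fun_eq_iff)
  ultimately have "linear_map k (vanishing K) (global_space \<F> pull \<TT>) ?E"
    by (auto simp: linear_map_def)
  moreover have "?E \<phi> K = \<phi>" if \<phi>: "\<phi> \<in> carrier (vanishing K)" for \<phi>
  proof -
    have KK: "K \<unlhd> K" using face_le_refl simp K by blast
    have "e K \<phi> = tr pull K K (e K \<phi>)" using compat[OF K KK KK \<phi>] by simp
    also have "\<dots> = \<phi>" by (rule extension_operatorD(2)[OF e[OF K KK] \<phi>])
    finally show ?thesis using K KK by simp
  qed
  ultimately show ?thesis
    by (simp add: local_extension_operator_def global_trace_def)
qed


text \<open>
  A simplex of dimension \<open>n\<close> has faces \<open>K\<close> and \<open>G\<close> of dimensions \<open>m\<close> and \<open>m + 1\<close> with \<open>K\<close> a face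
  of \<open>G\<close>, and the pair is isomorphic to \<open>T\<^sup>m\<close> inside \<open>Q\<^sup>m\<^sup>+\<^sup>1\<close>.
\<close>

lemma simplicial_extension_operator_if_local:
  assumes T: "is_simplicial_complex \<TT>" and dim: "max_dim \<TT> n" and "m < n"
    and loc: "\<And>K. K \<in> \<TT> \<Longrightarrow> \<exists>E. local_extension_operator k \<F> pull \<TT> K E"
  shows "\<exists>E. simplicial_extension_operator k \<F> pull m E"
proof -
  obtain F where F: "F \<in> \<TT>" "simplex_dim F = n" using dim by (auto simp: max_dim_def)
  have sF: "is_simplex F" using T F by (simp add: is_simplicial_complex_def)
  have cardF: "card (vertices F) = n + 1"
    using card_vertices[OF sF] F(2) by simp
  obtain D where D: "D \<subseteq> vertices F" "card D = m + 1" "finite D"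
    using obtain_subset_with_card_n[of "m + 1" "vertices F"] cardF \<open>m < n\<close> by auto
  have "D \<noteq> vertices F" using D cardF \<open>m < n\<close> by auto
  then obtain v where v: "v \<in> vertices F" "v \<notin> D" using D(1) by blast
  have D0: "D \<noteq> {}" using D(2) by auto
  let ?K = "convex hull D" and ?G = "convex hull (insert v D)"
  have vD: "insert v D \<subseteq> vertices F" "insert v D \<noteq> {}" using v D by auto
  note K = simplex_convex_hull[OF sF D(1) D0] and G = simplex_convex_hull[OF sF vD]
  have inT: "?K \<in> \<TT>" "?G \<in> \<TT>"
    using T F(1) convex_hull_face_le[OF sF D(1) D0] convex_hull_face_le[OF sF vD]
    unfolding is_simplicial_complex_def by blast+
  have KG: "?K \<unlhd> ?G" using face_le_iff_vertices[OF K(1) G(1)] K(2) G(2) by auto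
  obtain E where "local_extension_operator k \<F> pull \<TT> ?K E" using loc inT by blast
  then have E: "extension_operator ?K ?G (\<lambda>\<phi>. E \<phi> ?G)"
    using local_extension_operator_restrict[OF T _ inT(2) KG] by blast
  have "card (basis_point ` {0..m}) = card D"
    using D(2) card_vertices_T_simplex T_simplex(2) by simp
  then obtain h where h: "bij_betw h (basis_point ` {0..m}) D"
    using finite_same_card_bij[of "basis_point ` {0..m}" D] D(3) by auto
  define f where "f x = (if x = 0 then v else h x)" for x
  have fh: "f x = h x" if "x \<in> basis_point ` {0..m}" for x
    using that basis_point_nonzero by (auto simp: f_def)
  have f0: "f 0 = v" by (simp add: f_def)
  have bij: "bij_betw f (vertices (T_simplex m)) (vertices ?K)"
    unfolding T_simplex(2) K(2) using h bij_betw_cong[of "basis_point ` {0..m}" f h D] fh by blast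
  have map: "vertex_map (Q_simplex (m + 1)) ?G f"
    using bij f0 G Q_simplex(1) K(2) unfolding vertex_map_def vertices_Q_simplex_Suc by (auto simp: bij_betw_def)
  have pre: "x \<in> vertices (T_simplex m)" if "x \<in> vertices (Q_simplex (m + 1))" "f x \<in> vertices ?K" for x
    using that v(2) f0 unfolding vertices_Q_simplex_Suc K(2) by auto
  show ?thesis
    unfolding simplicial_extension_operator_iff
    using extension_operator_transport(1)[OF E KG T_simplex(3) map bij pre] by blast
qed

text \<open>
  For \<open>m = dim K < n\<close>, every simplex \<open>F\<close> that contains \<open>K\<close> is projected to \<open>Q\<^sup>m\<^sup>+\<^sup>1\<close> by matching
  \<open>K\<close> with \<open>T\<^sup>m\<close> and sending all vertices outside \<open>K\<close> to the origin.  These projections are given by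
  one vertex map, so they agree on common faces, and the pulled back extensions fit together.
\<close>

lemma local_extension_operator_if_simplicial:
  assumes T: "is_simplicial_complex \<TT>" and dim: "max_dim \<TT> n" and K: "K \<in> \<TT>"
    and simpl: "\<And>m. m < n \<Longrightarrow> \<exists>E. simplicial_extension_operator k \<F> pull m E"
  shows "\<exists>E. local_extension_operator k \<F> pull \<TT> K E"
proof -
  have s: "is_simplex F" if "F \<in> \<TT>" for F using T that by (simp add: is_simplicial_complex_def)
  note card = card_vertices[OF s]
  have le: "simplex_dim F \<le> n" if "F \<in> \<TT>" for F using dim that by (simp add: max_dim_def)
  define m where "m = simplex_dim K"
  have "m \<le> n" unfolding m_def by (rule le[OF K])
  then consider "m = n" | "m < n" by linarith
  then show ?thesis
  proof cases
    case 1
    have top: "F = K" if F: "F \<in> \<TT>" "K \<unlhd> F" for F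
    proof -
      have "vertices K \<subseteq> vertices F" using F face_le_iff_vertices s K by blast
      moreover have "card (vertices F) \<le> card (vertices K)"
        using card[OF K] card[OF F(1)] le[OF F(1)] 1 m_def by simp
      ultimately have "vertices K = vertices F"
        using card_seteq simplexD(1)[OF s[OF F(1)]] by blast
      then show ?thesis using simplex_eq_iff_vertices s K F(1) by blast
    qed
    note incl = extension_operator_inclusion[OF s[OF K]]
    have "local_extension_operator k \<F> pull \<TT> K
           (\<lambda>\<phi>. \<lambda>F\<in>\<TT>. if K \<unlhd> F then \<phi> else \<zero>\<^bsub>\<F> F\<^esub>)"
    proof (rule local_extension_operator_glue[OF T K, where e = "\<lambda>F \<phi>. \<phi>"])
      show "extension_operator K F (\<lambda>\<phi>. \<phi>)" if "F \<in> \<TT>" "K \<unlhd> F" for F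
        using top[OF that] incl by simp
      fix F S \<phi> assume FS: "F \<in> \<TT>" "S \<unlhd> F" "K \<unlhd> S" and \<phi>: "\<phi> \<in> carrier (vanishing K)"
      have "F = K" using top[OF FS(1)] face_le_trans[OF s[OF FS(1)] FS(3,2)] by blast
      moreover have "S = K"
        using top FS T unfolding is_simplicial_complex_def by blast
      ultimately show "tr pull F S \<phi> = \<phi>" using extension_operatorD(2)[OF incl \<phi>] by simp
    qed
    then show ?thesis by blast
  next
    case 2
    then obtain E where E: "extension_operator (T_simplex m) (Q_simplex (m + 1)) E"
      using simpl simplicial_extension_operator_iff by blast
    have "card (vertices (T_simplex m)) = card (vertices K)"
      using card[OF K] m_def card_vertices_T_simplex by simp
    then obtain h where h: "bij_betw h (vertices K) (vertices (T_simplex m))"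
      using finite_same_card_bij[OF simplexD(1)[OF s[OF K]] simplexD(1)[OF T_simplex(1)]] by metis
    \<comment> \<open>not dependent on the simplex containing \<open>K\<close>, which is what makes the extensions compatible\<close>
    define f where "f x = (if x \<in> vertices K then h x else 0)" for x
    have bij: "bij_betw f (vertices K) (vertices (T_simplex m))"
      using h bij_betw_cong[of "vertices K" f h] by (simp add: f_def)
    have map: "vertex_map F (Q_simplex (m + 1)) f" if "F \<in> \<TT>" for F
      using bij s[OF that] Q_simplex(1) unfolding vertex_map_def vertices_Q_simplex_Suc by (auto simp: f_def bij_betw_def)
    have pre: "x \<in> vertices K" if "f x \<in> vertices (T_simplex m)" for x
      using that basis_point_nonzero unfolding T_simplex(2) by (auto simp: f_def split: if_splits)
    define e where
      "e F = vpull F (Q_simplex (m + 1)) f \<circ> E \<circ> vpull (T_simplex m) K (inv_into (vertices K) f)" for F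
    have "local_extension_operator k \<F> pull \<TT> K
           (\<lambda>\<phi>. \<lambda>F\<in>\<TT>. if K \<unlhd> F then e F \<phi> else \<zero>\<^bsub>\<F> F\<^esub>)"
    proof (rule local_extension_operator_glue[OF T K])
      show "extension_operator K F (e F)" if "F \<in> \<TT>" "K \<unlhd> F" for F
        unfolding e_def
        by (rule extension_operator_transport(1)[OF E T_simplex(3) that(2) map[OF that(1)] bij pre])
      show "tr pull F S (e F \<phi>) = e S \<phi>"
        if "F \<in> \<TT>" "S \<unlhd> F" "K \<unlhd> S" "\<phi> \<in> carrier (vanishing K)" for F S \<phi>
        unfolding e_def
        by (rule extension_operator_transport(2)[OF E T_simplex(3)
              face_le_trans[OF s[OF that(1)] that(3,2)] map[OF that(1)] bij pre that(2,4)])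
    qed
    then show ?thesis by blast
  qed
qed

end

theorem theorem3p9:
  fixes k :: "('k, 'r) ring_scheme"
    and \<F> :: "point set \<Rightarrow> ('k, 'v) module"
    and pull :: "point set \<Rightarrow> point set \<Rightarrow> (point \<Rightarrow> point) \<Rightarrow> 'v \<Rightarrow> 'v"
    and \<TT> :: "point set set"
    and n :: nat
  assumes "simplicial_function_space k \<F> pull"
    and "is_simplicial_complex \<TT>"
    and "max_dim \<TT> n"
  shows "(\<forall>K\<in>\<TT>. \<exists>E. local_extension_operator k \<F> pull \<TT> K E) \<longleftrightarrow>
         (\<forall>m<n. \<exists>E. simplicial_extension_operator k \<F> pull m E)"
proof -
  interpret simplicial_function_space k \<F> pull by fact
  show ?thesis
    using simplicial_extension_operator_if_local[OF assms(2,3)]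
      local_extension_operator_if_simplicial[OF assms(2,3)] by blast
qed

end
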